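(* If $\mathrm{P} = \mathrm{NP}$, then no $\mathrm{NP}$-complete set $S$ has the property that there is a set $D\in\mathrm{P}$ such that both $S\cap D$ and $S\cap\overline{D}$ are $\mathrm{NP}$-incomplete (i.e., are in $\mathrm{NP}$ yet are not $\mathrm{NP}$-complete).
   Context: All sets are over $\Sigma=\{0,1\}$; $\overline{D}=\Sigma^*\setminus D$. $\mathrm{NP}$-completeness is with respect to polynomial-time many-one reductions ($A \le^p_m B$ iff there is a polynomial-time computable $f$ with $x\in A\iff f(x)\in B$; $B$ is $\mathrm{NP}$-complete if $B\in\mathrm{NP}$ and every $\mathrm{NP}$ set $\le^p_m$-reduces to $B$). *)

theory Defs
  imports Main "HOL-Computational_Algebra.Polynomial"
begin

type_synonym word = "bool list"

text \<open>
  Nondeterministic multitape Turing machines. States and tape symbols are natural numbers; the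
  symbol 0 is the blank, and 1 and 2 encode the input letters \<open>False\<close> (0) and \<open>True\<close> (1).
  A transition maps a state and the scanned symbols (one per tape) to a successor state
  and, for each tape, a symbol to write and a head movement in \<open>{-1, 0, 1}\<close>.
\<close>

record tm =
  tm_tapes :: nat
  tm_states :: "nat set"
  tm_symbols :: "nat set"
  tm_start :: nat
  tm_accepting :: "nat set"
  tm_delta :: "((nat \<times> nat list) \<times> (nat \<times> (nat \<times> int) list)) set"

definition turing_machine :: "tm \<Rightarrow> bool" where
  "turing_machine M \<longleftrightarrow>
     tm_tapes M \<ge> 1 \<and>
     finite (tm_states M) \<and> finite (tm_symbols M) \<and> {0, 1, 2} \<subseteq> tm_symbols M \<and>
     tm_start M \<in> tm_states M \<and> tm_accepting M \<subseteq> tm_states M \<and>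
     (\<forall>q as q' bs. ((q, as), (q', bs)) \<in> tm_delta M \<longrightarrow>
        q \<in> tm_states M \<and> length as = tm_tapes M \<and> set as \<subseteq> tm_symbols M \<and>
        q' \<in> tm_states M \<and> length bs = tm_tapes M \<and> set bs \<subseteq> tm_symbols M \<times> {-1, 0, 1})"

definition deterministic :: "tm \<Rightarrow> bool" where
  "deterministic M \<longleftrightarrow> single_valued (tm_delta M)"

text \<open>A tape is two-way infinite; it is given by its contents and its head position.\<close>

type_synonym tape = "(int \<Rightarrow> nat) \<times> int"
type_synonym config = "nat \<times> tape list"

fun scanned :: "tape \<Rightarrow> nat" where
  "scanned (t, h) = t h"

fun write_move :: "nat \<times> int \<Rightarrow> tape \<Rightarrow> tape" where
  "write_move (b, d) (t, h) = (t(h := b), h + d)"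

definition step :: "tm \<Rightarrow> (config \<times> config) set" where
  "step M = {((q, ts), (q', map2 write_move bs ts)) | q ts q' bs.
               ((q, map scanned ts), (q', bs)) \<in> tm_delta M}"

definition word_contents :: "word \<Rightarrow> int \<Rightarrow> nat" where
  "word_contents x i =
     (if 0 \<le> i \<and> i < int (length x) then (if x ! nat i then 2 else 1) else 0)"

definition init_config :: "tm \<Rightarrow> word \<Rightarrow> config" where
  "init_config M x =
     (tm_start M, (word_contents x, 0) # replicate (tm_tapes M - 1) (word_contents [], 0))"

definition halted :: "tm \<Rightarrow> config \<Rightarrow> bool" where
  "halted M c \<longleftrightarrow> c \<notin> Domain (step M)"

definition accepts :: "tm \<Rightarrow> word \<Rightarrow> bool" where
  "accepts M x \<longleftrightarrow>
     (\<exists>c. (init_config M x, c) \<in> (step M)\<^sup>* \<and> halted M c \<and> fst c \<in> tm_accepting M)"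

text \<open>Every computation path, accepting or not, has polynomially bounded length.\<close>

definition poly_time :: "tm \<Rightarrow> bool" where
  "poly_time M \<longleftrightarrow>
     (\<exists>p :: nat poly. \<forall>x n c. (init_config M x, c) \<in> step M ^^ n \<longrightarrow> n \<le> poly p (length x))"

definition class_P :: "word set set" where
  "class_P = {{x. accepts M x} | M. turing_machine M \<and> deterministic M \<and> poly_time M}"

definition class_NP :: "word set set" where
  "class_NP = {{x. accepts M x} | M. turing_machine M \<and> poly_time M}"

text \<open>
  The output is found on the last tape: upon halting, this tape holds exactly the output word,
  starting at cell 0, and is blank elsewhere. Halting in any state counts.
\<close>

definition computes :: "tm \<Rightarrow> (word \<Rightarrow> word) \<Rightarrow> bool" where
  "computes M f \<longleftrightarrow>
     (\<forall>x. \<exists>c. (init_config M x, c) \<in> (step M)\<^sup>* \<and> halted M c \<and>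
            fst (last (snd c)) = word_contents (f x))"

definition poly_time_computable :: "(word \<Rightarrow> word) \<Rightarrow> bool" where
  "poly_time_computable f \<longleftrightarrow>
     (\<exists>M. turing_machine M \<and> deterministic M \<and> poly_time M \<and> computes M f)"

definition poly_reducible :: "word set \<Rightarrow> word set \<Rightarrow> bool"  (infix "\<le>pm" 50) where
  "A \<le>pm B \<longleftrightarrow> (\<exists>f. poly_time_computable f \<and> (\<forall>x. x \<in> A \<longleftrightarrow> f x \<in> B))"

definition NP_complete :: "word set \<Rightarrow> bool" where
  "NP_complete B \<longleftrightarrow> B \<in> class_NP \<and> (\<forall>A \<in> class_NP. A \<le>pm B)"

definition NP_incomplete :: "word set \<Rightarrow> bool" where
  "NP_incomplete B \<longleftrightarrow> B \<in> class_NP \<and> \<not> NP_complete B"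

end

theory Submission
  imports Defs "HOL-Library.Countable" "HOL-Library.Sublist"
begin

text \<open>
  If P = NP, every NP set \<open>B\<close> other than \<open>{}\<close> and \<open>UNIV\<close> is NP-complete: an NP set \<open>A\<close> is decided
  in deterministic polynomial time, so it reduces to \<open>B\<close> by a function with only two values, one in
  \<open>B\<close> and one outside. Hence if \<open>S \<inter> D\<close> and \<open>S \<inter> - D\<close> are both NP-incomplete, each is \<open>{}\<close> or
  \<open>UNIV\<close>, and so is their union \<open>S\<close>. But no nontrivial NP set reduces to a trivial one.
\<close>

section \<open>Runs of Turing machines\<close>

text \<open>Two runs from \<open>a\<close> share their first step, so both can be shortened by it;
  once the halting run is used up, the other cannot continue either.\<close>

lemma single_valued_relpow_le_halting:
  assumes "single_valued R" "(a, c) \<in> R ^^ m" "c \<notin> Domain R" "(a, d) \<in> R ^^ n"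
  shows "n \<le> m"
  using assms(2,4)
proof (induction m arbitrary: a n)
  case 0
  with assms(3) show ?case
    by (cases n) (auto elim: relpow_Suc_E2 simp del: relpow.simps(2))
next
  case (Suc m)
  obtain b where b: "(a, b) \<in> R" "(b, c) \<in> R ^^ m"
    using Suc.prems(1) by (blast elim: relpow_Suc_E2)
  show ?case
  proof (cases n)
    case (Suc n')
    with Suc.prems obtain b' where "(a, b') \<in> R" "(b', d) \<in> R ^^ n'"
      by (blast elim: relpow_Suc_E2)
    with b assms(1) have "(b, d) \<in> R ^^ n'"
      by (auto dest: single_valuedD)
    with Suc Suc.IH[OF b(2)] show ?thesis by simp
  qed simp
qed

lemma single_valued_relpow_halting_unique:
  assumes "single_valued R" "(a, c) \<in> R ^^ m" "c \<notin> Domain R"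
    "(a, d) \<in> R ^^ n" "d \<notin> Domain R"
  shows "c = d"
proof -
  have "m = n"
    using single_valued_relpow_le_halting[OF assms(1)] assms(2-5) by (meson le_antisym)
  with assms single_valued_relpow[OF assms(1)] show ?thesis
    by (metis single_valuedD)
qed

section \<open>Halting, running time and acceptance\<close>

lemma deterministic_step:
  assumes "deterministic M"
  shows "single_valued (step M)"
  using assms unfolding deterministic_def single_valued_def step_def by fastforce

lemma stepI:
  assumes "((q, map scanned ts), (q', bs)) \<in> tm_delta M"
  shows "((q, ts), (q', map2 write_move bs ts)) \<in> step M"
  using assms unfolding step_def by blast

lemma halted_iff: "halted M (q, ts) \<longleftrightarrow> (q, map scanned ts) \<notin> Domain (tm_delta M)"
proof -
  have "(q, ts) \<in> Domain (step M) \<longleftrightarrow> (q, map scanned ts) \<in> Domain (tm_delta M)"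
    by (auto simp: step_def) (blast dest: stepI[unfolded step_def])
  then show ?thesis
    by (simp add: halted_def)
qed

text \<open>The time bound caps the length of every run on \<open>x\<close>, so a longest run
  exists; its last configuration is halted, as another step would make it longer.\<close>

lemma poly_time_halts:
  assumes "poly_time M"
  obtains p where "\<And>x. \<exists>n c. n \<le> poly p (length x) \<and> (init_config M x, c) \<in> step M ^^ n \<and> halted M c"
proof -
  obtain p where p: "\<And>x n c. (init_config M x, c) \<in> step M ^^ n \<Longrightarrow> n \<le> poly p (length x)"
    using assms unfolding poly_time_def by blast
  have "\<exists>n c. n \<le> poly p (length x) \<and> (init_config M x, c) \<in> step M ^^ n \<and> halted M c" for x
  proof -
    let ?Q = "\<lambda>n. \<exists>c. (init_config M x, c) \<in> step M ^^ n"
    have "?Q 0" by auto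
    then have "?Q (Greatest ?Q)"
      by (rule GreatestI_nat) (use p in blast)
    have max: "n \<le> Greatest ?Q" if "?Q n" for n
      using that by (rule Greatest_le_nat) (use p in blast)
    obtain c where c: "(init_config M x, c) \<in> step M ^^ Greatest ?Q"
      using \<open>?Q (Greatest ?Q)\<close> by blast
    have "halted M c"
      unfolding halted_def
    proof
      assume "c \<in> Domain (step M)"
      then have "?Q (Suc (Greatest ?Q))"
        using c by (blast intro: relpow_Suc_I)
      from max[OF this] show False by simp
    qed
    with c p show ?thesis by blast
  qed
  then show thesis by (rule that)
qed

text \<open>While \<open>poly_time\<close> speaks of all runs, in a deterministic machine a single
  halting run already bounds the length of the others.\<close>

lemma poly_timeI:
  assumes "deterministic M"
    and "\<And>x. \<exists>n c. n \<le> poly p (length x) \<and> (init_config M x, c) \<in> step M ^^ n \<and> halted M c"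
  shows "poly_time M"
  unfolding poly_time_def
proof (intro exI[of _ p] allI impI)
  fix x n c
  assume c: "(init_config M x, c) \<in> step M ^^ n"
  obtain m d where "m \<le> poly p (length x)" "(init_config M x, d) \<in> step M ^^ m" "halted M d"
    using assms(2) by blast
  with single_valued_relpow_le_halting[OF deterministic_step[OF assms(1)] _ _ c]
  show "n \<le> poly p (length x)"
    unfolding halted_def by (meson le_trans)
qed

lemma deterministic_accepts_iff:
  assumes "deterministic M" "(init_config M x, c) \<in> step M ^^ n" "halted M c"
  shows "accepts M x \<longleftrightarrow> fst c \<in> tm_accepting M"
proof
  assume "accepts M x"
  then obtain d m where "(init_config M x, d) \<in> step M ^^ m" "halted M d" "fst d \<in> tm_accepting M"
    unfolding accepts_def by (auto simp: rtrancl_power)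
  with single_valued_relpow_halting_unique[OF deterministic_step[OF assms(1)]] assms(2,3)
  show "fst c \<in> tm_accepting M"
    unfolding halted_def by metis
next
  assume "fst c \<in> tm_accepting M"
  with assms(2,3) show "accepts M x"
    unfolding accepts_def rtrancl_power by blast
qed

text \<open>An invariant of runs. It ensures that the symbols scanned when \<open>M\<close> halts
  lie in \<open>reading M\<close>, where the machine built below has a transition to go on.\<close>

definition valid_config :: "tm \<Rightarrow> config \<Rightarrow> bool" where
  "valid_config M c \<longleftrightarrow> fst c \<in> tm_states M \<and> length (snd c) = tm_tapes M \<and>
     (\<forall>t \<in> set (snd c). range (fst t) \<subseteq> tm_symbols M)"

lemma valid_config_scanned:
  assumes "valid_config M (q, ts)"
  shows "q \<in> tm_states M" "length ts = tm_tapes M" "set (map scanned ts) \<subseteq> tm_symbols M"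
  using assms unfolding valid_config_def by (auto, fastforce)

lemma valid_config_init:
  assumes "turing_machine M"
  shows "valid_config M (init_config M x)"
  using assms unfolding turing_machine_def valid_config_def init_config_def
  by (auto simp: word_contents_def)

lemma valid_config_step:
  assumes "turing_machine M" "valid_config M c" "(c, c') \<in> step M"
  shows "valid_config M c'"
proof -
  obtain q ts q' bs where c: "c = (q, ts)" "c' = (q', map2 write_move bs ts)"
    and d: "((q, map scanned ts), (q', bs)) \<in> tm_delta M"
    using assms(3) unfolding step_def by blast
  have bs: "q' \<in> tm_states M" "length bs = tm_tapes M" "set bs \<subseteq> tm_symbols M \<times> {-1, 0, 1}"
    using assms(1) d unfolding turing_machine_def by blast+
  have "range (fst (write_move b t)) \<subseteq> tm_symbols M" if "(b, t) \<in> set (zip bs ts)" for b t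
  proof -
    have "fst b \<in> tm_symbols M"
      using that bs(3) by (fastforce dest: set_zip_leftD)
    moreover have "range (fst t) \<subseteq> tm_symbols M"
      using that assms(2) unfolding c valid_config_def by (auto dest: set_zip_rightD)
    ultimately show ?thesis
      by (cases b; cases t) auto
  qed
  then have "\<forall>t \<in> set (map2 write_move bs ts). range (fst t) \<subseteq> tm_symbols M"
    unfolding set_map by (intro ballI) (elim imageE, auto simp only: split_beta prod.collapse)
  with bs assms(2) show ?thesis
    unfolding c valid_config_def by simp
qed

section \<open>Reductions with two values\<close>

abbreviation blank_tape :: tape where
  "blank_tape \<equiv> (word_contents [], 0)"

definition stay :: "nat list \<Rightarrow> (nat \<times> int) list" where
  "stay as = map (\<lambda>a. (a, 0)) as"

lemma stay_simps [simp]: "length (stay as) = length as" "set (stay as) = (\<lambda>a. (a, 0)) ` set as"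
  by (auto simp: stay_def)

lemma map2_write_move_stay [simp]: "map2 write_move (stay (map scanned ts)) ts = ts"
  by (induction ts) (auto simp: stay_def)

text \<open>Writing a letter on the first cell after a word appends it, so the output can be
  produced from left to right.\<close>

lemma word_contents_snoc:
  "word_contents (w @ [b]) = (word_contents w)(int (length w) := if b then 2 else 1)"
  by (auto simp: word_contents_def fun_eq_iff nth_append nat_less_iff)

text \<open>In this state of the machine below, the word \<open>w\<close> remains to be written.\<close>

definition write_state :: "tm \<Rightarrow> word \<Rightarrow> nat" where
  "write_state M w = Suc (Max (tm_states M)) + to_nat w"

lemma write_state_eq_iff [simp]: "write_state M w = write_state M w' \<longleftrightarrow> w = w'"
  by (simp add: write_state_def)

text \<open>Write states lie above the maximum of the finite set \<open>tm_states M\<close>. Their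
  freshness separates the writing phase from the run of \<open>M\<close>.\<close>

lemma write_state_notin:
  assumes "turing_machine M"
  shows "write_state M w \<notin> tm_states M"
proof
  assume "write_state M w \<in> tm_states M"
  then have "write_state M w \<le> Max (tm_states M)"
    using assms by (intro Max_ge) (auto simp: turing_machine_def)
  then show False by (simp add: write_state_def)
qed

definition reading :: "tm \<Rightarrow> nat list set" where
  "reading M = {as. length as = tm_tapes M \<and> set as \<subseteq> tm_symbols M}"

text \<open>
  Runs \<open>M\<close> beside an additional blank last tape; where \<open>M\<close> halts, goes on to write \<open>u\<close> or \<open>v\<close> on
  that tape, depending on the verdict of \<open>M\<close>.
\<close>

definition branch_tm :: "tm \<Rightarrow> word \<Rightarrow> word \<Rightarrow> tm" where
  "branch_tm M u v = \<lparr>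
     tm_tapes = Suc (tm_tapes M),
     tm_states = tm_states M \<union> write_state M ` {w. suffix w u \<or> suffix w v},
     tm_symbols = tm_symbols M,
     tm_start = tm_start M,
     tm_accepting = {},
     tm_delta =
       {((q, as @ [0]), (q', bs @ [(0, 0)])) | q as q' bs. ((q, as), (q', bs)) \<in> tm_delta M} \<union>
       {((q, as @ [0]), (write_state M (if q \<in> tm_accepting M then u else v), stay as @ [(0, 0)])) |
          q as. q \<in> tm_states M \<and> as \<in> reading M \<and> (q, as) \<notin> Domain (tm_delta M)} \<union>
       {((write_state M (b # w), as @ [0]),
         (write_state M w, stay as @ [(if b then 2 else 1, 1)])) |
          b w as. as \<in> reading M \<and> (suffix (b # w) u \<or> suffix (b # w) v)}\<rparr>"

lemma branch_tm_simps [simp]: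
  "tm_tapes (branch_tm M u v) = Suc (tm_tapes M)"
  "tm_start (branch_tm M u v) = tm_start M"
  "tm_symbols (branch_tm M u v) = tm_symbols M"
  "tm_accepting (branch_tm M u v) = {}"
  "tm_states (branch_tm M u v) = tm_states M \<union> write_state M ` {w. suffix w u \<or> suffix w v}"
  by (simp_all add: branch_tm_def)

lemma turing_machine_states:
  assumes "turing_machine M" "((q, as), (q', bs)) \<in> tm_delta M"
  shows "q \<in> tm_states M" "q' \<in> tm_states M" "as \<in> reading M" "length bs = tm_tapes M"
    "set bs \<subseteq> tm_symbols M \<times> {-1, 0, 1}"
  using assms unfolding turing_machine_def reading_def by blast+

lemma turing_machine_branch_tm:
  assumes "turing_machine M"
  shows "turing_machine (branch_tm M u v)"
proof -
  let ?B = "branch_tm M u v"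
  have sym: "{0, 1, 2} \<subseteq> tm_symbols M"
    using assms by (auto simp: turing_machine_def)
  \<comment> \<open>What remains to be written is always a suffix of \<open>u\<close> or
    \<open>v\<close>, so finitely many new states suffice.\<close>
  have "{w. suffix w u \<or> suffix w v} = set (suffixes u) \<union> set (suffixes v)"
    by auto
  then have "finite {w. suffix w u \<or> suffix w v}"
    by simp
  moreover have "q \<in> tm_states ?B \<and> length as = tm_tapes ?B \<and> set as \<subseteq> tm_symbols ?B \<and>
        q' \<in> tm_states ?B \<and> length bs = tm_tapes ?B \<and> set bs \<subseteq> tm_symbols ?B \<times> {-1, 0, 1}"
    if "((q, as), (q', bs)) \<in> tm_delta ?B" for q as q' bs
  proof -
    from that consider
      (run) as' bs' where "as = as' @ [0]" "bs = bs' @ [(0, 0)]" "((q, as'), (q', bs')) \<in> tm_delta M"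
    | (halt) as' w where "as = as' @ [0]" "bs = stay as' @ [(0, 0)]" "q \<in> tm_states M"
        "as' \<in> reading M" "q' = write_state M w" "w = u \<or> w = v"
    | (out) b w as' where "as = as' @ [0]" "bs = stay as' @ [(if b then 2 else 1, 1)]"
        "as' \<in> reading M" "q = write_state M (b # w)" "q' = write_state M w"
        "suffix (b # w) u \<or> suffix (b # w) v"
      by (auto simp: branch_tm_def)
    then show ?thesis
    proof cases
      case run
      with turing_machine_states[OF assms run(3)] sym show ?thesis
        by (auto simp: reading_def)
    next
      case halt
      with sym show ?thesis
        by (auto simp: reading_def)
    next
      case out
      with sym show ?thesis
        by (auto simp: reading_def dest: suffix_ConsD)
    qed
  qed
  ultimately show ?thesis
    using assms unfolding turing_machine_def by fastforce
qed

text \<open>The three families of transitions have disjoint domains: the first two are separated by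
  \<open>Domain (tm_delta M)\<close>, the third by its fresh states. Within the third, injectivity
  of \<open>write_state\<close> recovers \<open>b\<close> and \<open>w\<close>.\<close>

lemma deterministic_branch_tm:
  assumes "turing_machine M" "deterministic M"
  shows "deterministic (branch_tm M u v)"
proof -
  note ns = write_state_notin[OF assms(1)]
  have sv: "y = z" if "(a, y) \<in> tm_delta M" "(a, z) \<in> tm_delta M" for a y z
    using assms(2) that by (auto simp: deterministic_def dest: single_valuedD)
  show ?thesis
    unfolding deterministic_def
  proof (rule single_valuedI)
    fix a y z
    assume "(a, y) \<in> tm_delta (branch_tm M u v)" "(a, z) \<in> tm_delta (branch_tm M u v)"
    then show "y = z"
      unfolding branch_tm_def
      by (auto dest: sv turing_machine_states(1)[OF assms(1)] simp: ns)
  qed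
qed

section \<open>Simulation of \<open>M\<close>, then writing of the output\<close>

lemma branch_tm_init:
  assumes "turing_machine M" "init_config M x = (q, ts)"
  shows "init_config (branch_tm M u v) x = (q, ts @ [blank_tape])"
proof -
  \<comment> \<open>Since \<open>M\<close> has at least one tape, the truncated subtraction in
    \<open>init_config\<close> is exact, and the additional blank tape can be split off at the
    end.\<close>
  have "tm_tapes M = Suc (tm_tapes M - 1)"
    using assms(1) by (simp add: turing_machine_def)
  then have "replicate (tm_tapes M) blank_tape
      = replicate (tm_tapes M - 1) blank_tape @ [blank_tape]"
    by (metis replicate_Suc replicate_append_same)
  with assms(2) show ?thesis
    by (auto simp: init_config_def)
qed

lemma scanned_blank [simp]: "scanned (word_contents w, int (length w)) = 0"
  by (simp add: word_contents_def)

lemma branch_tm_run_step: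
  assumes "turing_machine M" "((q, ts), (q', ts')) \<in> step M" "length ts = tm_tapes M"
  shows "((q, ts @ [blank_tape]), (q', ts' @ [blank_tape])) \<in> step (branch_tm M u v)"
proof -
  obtain bs where bs: "((q, map scanned ts), (q', bs)) \<in> tm_delta M" "ts' = map2 write_move bs ts"
    using assms(2) unfolding step_def by blast
  have "((q, map scanned (ts @ [blank_tape])), (q', bs @ [(0, 0)])) \<in> tm_delta (branch_tm M u v)"
    using bs(1) by (auto simp: branch_tm_def word_contents_def)
  moreover have "map2 write_move (bs @ [(0, 0)]) (ts @ [blank_tape]) = ts' @ [blank_tape]"
    using turing_machine_states(4)[OF assms(1) bs(1)] assms(3)
    by (auto simp: bs(2) word_contents_def)
  ultimately show ?thesis
    by (metis stepI)
qed

text \<open>Validity is carried through the induction because it supplies the number of tapes, which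
  \<open>branch_tm_run_step\<close> needs to keep the last tape aligned under
  \<open>map2\<close>.\<close>

lemma branch_tm_run:
  assumes "turing_machine M" "((q, ts), (q', ts')) \<in> step M ^^ n" "valid_config M (q, ts)"
  shows "((q, ts @ [blank_tape]), (q', ts' @ [blank_tape])) \<in> step (branch_tm M u v) ^^ n
    \<and> valid_config M (q', ts')"
  using assms(2)
proof (induction n arbitrary: q' ts')
  case 0
  with assms(3) show ?case by simp
next
  case (Suc n)
  then obtain r rs where r: "((q, ts), (r, rs)) \<in> step M ^^ n" "((r, rs), (q', ts')) \<in> step M"
    by auto
  note IH = Suc.IH[OF r(1)]
  then have "((r, rs @ [blank_tape]), (q', ts' @ [blank_tape])) \<in> step (branch_tm M u v)"
    by (intro branch_tm_run_step[OF assms(1) r(2)]) (auto dest: valid_config_scanned)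
  with IH r(2) valid_config_step[OF assms(1)] show ?case
    by (meson relpow_Suc_I)
qed

lemma branch_tm_halt_step:
  assumes "valid_config M (q, ts)" "halted M (q, ts)"
  shows "((q, ts @ [blank_tape]),
      (write_state M (if q \<in> tm_accepting M then u else v), ts @ [blank_tape]))
    \<in> step (branch_tm M u v)"
proof -
  have "map scanned ts \<in> reading M"
    using valid_config_scanned[OF assms(1)] by (auto simp: reading_def)
  then have "((q, map scanned (ts @ [blank_tape])),
      (write_state M (if q \<in> tm_accepting M then u else v), stay (map scanned ts) @ [(0, 0)]))
    \<in> tm_delta (branch_tm M u v)"
    using assms valid_config_scanned(1)[OF assms(1)]
    by (auto simp: branch_tm_def halted_iff word_contents_def)
  \<comment> \<open>Writing 0 on a blank cell without moving leaves the last tape as it was.\<close>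
  from stepI[OF this] show ?thesis
    by (simp split del: if_split add: fun_upd_idem word_contents_def)
qed

text \<open>Induction on the rest \<open>w\<close>, for every prefix \<open>w'\<close> already
  written: the head stands on the blank cell just after \<open>w'\<close>, and each step moves one
  letter from \<open>w\<close> to \<open>w'\<close>.\<close>

lemma branch_tm_write:
  assumes "map scanned ts \<in> reading M" "suffix w u \<or> suffix w v"
  shows "((write_state M w, ts @ [(word_contents w', int (length w'))]),
      (write_state M [], ts @ [(word_contents (w' @ w), int (length (w' @ w)))]))
    \<in> step (branch_tm M u v) ^^ length w"
  using assms(2)
proof (induction w arbitrary: w')
  case Nil
  then show ?case by simp
next
  case (Cons b w)
  let ?t = "(word_contents w', int (length w'))"
  have "((write_state M (b # w), map scanned (ts @ [?t])),
      (write_state M w, stay (map scanned ts) @ [(if b then 2 else 1, 1)]))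
    \<in> tm_delta (branch_tm M u v)"
    using assms(1) Cons.prems unfolding map_append list.map scanned_blank
    by (auto simp: branch_tm_def)
  from stepI[OF this]
  have "((write_state M (b # w), ts @ [?t]),
      (write_state M w, ts @ [(word_contents (w' @ [b]), int (length (w' @ [b])))]))
    \<in> step (branch_tm M u v)"
    by (simp add: word_contents_snoc add.commute)
  moreover have "suffix w u \<or> suffix w v"
    using Cons.prems by (auto dest: suffix_ConsD)
  note Cons.IH[OF this, of "w' @ [b]"]
  ultimately show ?case
    by (auto intro: relpow_Suc_I2 simp del: relpow.simps)
qed

text \<open>With nothing left to write no transition applies: this state is not one of
  \<open>M\<close>, and the writing transitions start from nonempty words.\<close>

lemma branch_tm_halted:
  assumes "turing_machine M"
  shows "halted (branch_tm M u v) (write_state M [], ts)"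
  using write_state_notin[OF assms, of "[]"] turing_machine_states(1)[OF assms]
  by (auto simp: halted_iff branch_tm_def)

lemma branch_tm_computes:
  fixes u v :: word
  assumes M: "turing_machine M" "deterministic M"
    and n: "(init_config M x, c) \<in> step M ^^ n" "halted M c"
  defines "w \<equiv> if accepts M x then u else v"
  shows "\<exists>d. (init_config (branch_tm M u v) x, d) \<in> step (branch_tm M u v) ^^ (n + 1 + length w) \<and>
    halted (branch_tm M u v) d \<and> fst (last (snd d)) = word_contents w"
proof -
  obtain q0 ts0 q ts where c: "init_config M x = (q0, ts0)" "c = (q, ts)"
    by (metis surj_pair)
  have w: "w = (if q \<in> tm_accepting M then u else v)"
    using deterministic_accepts_iff[OF M(2) n] by (simp add: w_def c)
  have "valid_config M (q0, ts0)"
    using valid_config_init[OF M(1), of x] by (simp add: c)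
  from branch_tm_run[OF M(1) n(1)[unfolded c] this]
  have run: "(init_config (branch_tm M u v) x, (q, ts @ [blank_tape])) \<in> step (branch_tm M u v) ^^ n"
    and valid: "valid_config M (q, ts)"
    by (auto simp: branch_tm_init[OF M(1) c(1)])
  have halt: "((q, ts @ [blank_tape]), (write_state M w, ts @ [blank_tape]))
      \<in> step (branch_tm M u v)"
    using branch_tm_halt_step[OF valid] n(2) by (simp add: c w)
  have "map scanned ts \<in> reading M" "suffix w u \<or> suffix w v"
    using valid_config_scanned[OF valid] by (auto simp: reading_def w)
  from branch_tm_write[OF this, of "[]"]
  have "((write_state M w, ts @ [blank_tape]),
      (write_state M [], ts @ [(word_contents w, int (length w))]))
    \<in> step (branch_tm M u v) ^^ length w"
    by simp
  \<comment> \<open>The time is \<open>n\<close> steps of simulation, one step to choose the word,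
    and one step per letter of \<open>w\<close>.\<close>
  with run halt
  have "(init_config (branch_tm M u v) x,
      (write_state M [], ts @ [(word_contents w, int (length w))]))
    \<in> step (branch_tm M u v) ^^ (n + 1 + length w)"
    unfolding relpow_add relpow_1 by (intro relcompI)
  with branch_tm_halted[OF M(1)] show ?thesis
    by fastforce
qed

section \<open>Two-valued functions in polynomial time\<close>

lemma poly_time_computable_if:
  assumes "A \<in> class_P"
  shows "poly_time_computable (\<lambda>x. if x \<in> A then u else v)"
proof -
  obtain M where A: "A = {x. accepts M x}"
    and M: "turing_machine M" "deterministic M" "poly_time M"
    using assms unfolding class_P_def by blast
  let ?B = "branch_tm M u v"
  obtain p where p:
    "\<And>x. \<exists>n c. n \<le> poly p (length x) \<and> (init_config M x, c) \<in> step M ^^ n \<and> halted M c"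
    using poly_time_halts[OF M(3)] by blast
  \<comment> \<open>The constant pays for the choosing step and for writing either word, whichever
    it is.\<close>
  let ?p = "p + [:1 + length u + length v:]"
  have B: "\<exists>n c. n \<le> poly ?p (length x) \<and> (init_config ?B x, c) \<in> step ?B ^^ n \<and> halted ?B c \<and>
      fst (last (snd c)) = word_contents (if x \<in> A then u else v)" for x
  proof -
    obtain n c where n: "n \<le> poly p (length x)"
      and c: "(init_config M x, c) \<in> step M ^^ n" "halted M c"
      using p by blast
    have "n + 1 + length (if accepts M x then u else v) \<le> poly ?p (length x)"
      using n by simp
    with branch_tm_computes[OF M(1,2) c, of u v] show ?thesis
      unfolding A mem_Collect_eq by blast
  qed
  have "computes ?B (\<lambda>x. if x \<in> A then u else v)"
    unfolding computes_def rtrancl_power using B by blast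
  moreover have "poly_time ?B"
    using B by (intro poly_timeI[OF deterministic_branch_tm[OF M(1,2)], of ?p]) blast
  ultimately show ?thesis
    unfolding poly_time_computable_def
    using turing_machine_branch_tm[OF M(1)] deterministic_branch_tm[OF M(1,2)] by blast
qed

lemma class_P_poly_reducible:
  assumes "A \<in> class_P" "B \<noteq> {}" "B \<noteq> UNIV"
  shows "A \<le>pm B"
proof -
  obtain u v where "u \<in> B" "v \<notin> B"
    using assms(2,3) by blast
  then have "\<forall>x. x \<in> A \<longleftrightarrow> (if x \<in> A then u else v) \<in> B"
    by simp
  with poly_time_computable_if[OF assms(1)] show ?thesis
    unfolding poly_reducible_def by blast
qed

section \<open>A nontrivial set in NP\<close>

text \<open>Accepts the words that begin with \<open>True\<close>, the letter encoded as 2.\<close>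

definition head_tm :: tm where
  "head_tm = \<lparr>tm_tapes = 1, tm_states = {0, 1}, tm_symbols = {0, 1, 2}, tm_start = 0,
     tm_accepting = {1}, tm_delta = {((0, [2]), (1, [(2, 0)]))}\<rparr>"

lemma head_tm_init: "init_config head_tm x = (0, [(word_contents x, 0)])"
  by (simp add: init_config_def head_tm_def)

lemma head_tm_halted: "halted head_tm (q, ts) \<longleftrightarrow> \<not> (q = 0 \<and> map scanned ts = [2])"
  by (auto simp: halted_iff head_tm_def)

lemma head_tm_step: "(c, c') \<in> step head_tm \<Longrightarrow> fst c = 0 \<and> fst c' = 1"
  by (auto simp: step_def head_tm_def)

lemma head_tm_accepts_True: "accepts head_tm [True]"
proof -
  have "((0, map scanned [(word_contents [True], 0)]), (1, [(2, 0)])) \<in> tm_delta head_tm"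
    by (simp add: head_tm_def word_contents_def)
  from stepI[OF this] show ?thesis
    unfolding accepts_def head_tm_init
    by (intro exI[of _ "(1, _)"] conjI r_into_rtrancl) (auto simp: head_tm_halted, simp add: head_tm_def)
qed

lemma head_tm_rejects_Nil: "\<not> accepts head_tm []"
proof
  assume "accepts head_tm []"
  then obtain c where c: "(init_config head_tm [], c) \<in> (step head_tm)\<^sup>*" "fst c = 1"
    by (auto simp: accepts_def head_tm_def)
  have "halted head_tm (init_config head_tm [])"
    by (simp add: head_tm_init head_tm_halted word_contents_def)
  with c(1) have "c = init_config head_tm []"
    unfolding halted_def by (auto elim: converse_rtranclE)
  with c(2) show False
    by (simp add: head_tm_init)
qed

text \<open>A step leads from state 0 to state 1, so no two steps can follow each other and 1 bounds
  every run.\<close>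

lemma poly_time_head_tm: "poly_time head_tm"
  unfolding poly_time_def
proof (intro exI[of _ "[:1:]"] allI impI)
  fix x n c
  assume c: "(init_config head_tm x, c) \<in> step head_tm ^^ n"
  show "n \<le> poly [:1:] (length x)"
  proof (rule ccontr)
    assume "\<not> ?thesis"
    then obtain k where "n = Suc (Suc k)"
      by (metis One_nat_def Suc_le_D not_less_eq_eq poly_1 one_pCons)
    with c obtain d e f where "(d, e) \<in> step head_tm" "(e, f) \<in> step head_tm"
      by auto
    then show False
      using head_tm_step[of d e] head_tm_step[of e f] by simp
  qed
qed

lemma nontrivial_class_NP:
  obtains A where "A \<in> class_NP" "A \<noteq> {}" "A \<noteq> UNIV"
proof
  have "turing_machine head_tm"
    by (auto simp: turing_machine_def head_tm_def)
  with poly_time_head_tm show "{x. accepts head_tm x} \<in> class_NP"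
    unfolding class_NP_def by blast
  show "{x. accepts head_tm x} \<noteq> {}" "{x. accepts head_tm x} \<noteq> UNIV"
    using head_tm_accepts_True head_tm_rejects_Nil by auto
qed

section \<open>Trivial sets and completeness\<close>

lemma NP_complete_nontrivial:
  assumes "NP_complete S"
  shows "S \<noteq> {}" "S \<noteq> UNIV"
proof -
  obtain A where A: "A \<in> class_NP" "A \<noteq> {}" "A \<noteq> UNIV"
    by (rule nontrivial_class_NP)
  then obtain f where "\<forall>x. x \<in> A \<longleftrightarrow> f x \<in> S"
    using assms unfolding NP_complete_def poly_reducible_def by blast
  \<comment> \<open>The reduction \<open>f\<close> maps a member of \<open>A\<close> into
    \<open>S\<close> and a nonmember outside \<open>S\<close>.\<close>
  with A show "S \<noteq> {}" "S \<noteq> UNIV"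
    by auto
qed

lemma NP_incomplete_trivial:
  assumes "class_P = class_NP" "NP_incomplete B"
  shows "B = {} \<or> B = UNIV"
  using assms class_P_poly_reducible unfolding NP_incomplete_def NP_complete_def by blast

theorem theorem5:
  assumes "class_P = class_NP"
  shows "\<not> (\<exists>S. NP_complete S \<and>
           (\<exists>D \<in> class_P. NP_incomplete (S \<inter> D) \<and> NP_incomplete (S \<inter> - D)))"
proof
  assume "\<exists>S. NP_complete S \<and>
           (\<exists>D \<in> class_P. NP_incomplete (S \<inter> D) \<and> NP_incomplete (S \<inter> - D))"
  then obtain S D where S: "NP_complete S"
    and D: "NP_incomplete (S \<inter> D)" "NP_incomplete (S \<inter> - D)"
    by blast
  \<comment> \<open>If either part is \<open>UNIV\<close>, so is \<open>S\<close>; otherwise both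
    parts are empty, and \<open>S\<close> is their union.\<close>
  have "S = {} \<or> S = UNIV"
    using NP_incomplete_trivial[OF assms D(1)] NP_incomplete_trivial[OF assms D(2)] by blast
  with NP_complete_nontrivial[OF S] show False
    by blast
qed

end
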